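(* Let $X_N=B_N\oplus T_N^{\mathrm{CZ}}\oplus T_N^{\mathrm{harm}}\oplus S_N\oplus R_N$, $\Gamma_N\subset X_N$, $\operatorname{dist}_0(\cdot,\Gamma_N)$ be as in the context, and let $\mathcal A_N\subset X_N$. Assume: (1) $\mathcal A_N$ is stable under positive quotient normalization; the baseline unit section $S_{N,0}:=\{D\in\mathcal A_N:\operatorname{dist}_0(D,\Gamma_N)=1\}$ is compact; and $M_N:\mathcal A_N\to[0,\infty)$ is continuous, positively homogeneous, and kernel-free: $M_N(D)=0\Rightarrow D\in\Gamma_N$. (2) There are $C_N^{\mathrm{res}}<\infty$, $\Delta_N\ge0$ and a nonnegative functional $\mathsf{Err}_N$ such that $M^{\mathrm{loc}}_\Lambda(D)\ge M_N(D)-C^{\mathrm{res}}_N\mathsf{Err}_N(D)-\Delta_N$ for every $D\in\mathcal A_N$. Then $$\mu_N:=\inf_{D\in S_{N,0}}M_N(D)>0,$$ and consequently, for every $D\in\mathcal A_N$, $$M^{\mathrm{loc}}_\Lambda(D)\ge\mu_N\operatorname{dist}_0(D,\Gamma_N)-C^{\mathrm{res}}_N\mathsf{Err}_N(D)-\Delta_N.$$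
   Context: $B_N,T_N^{\mathrm{CZ}},T_N^{\mathrm{harm}},S_N,R_N$ are finite-dimensional normed spaces (baseline, Calderón–Zygmund tail, harmonic tail, source, residual coordinates); elements of $X_N$ are written $D=(b,t^{\mathrm{CZ}},t^{\mathrm{harm}},s,r)$. $\Gamma_N=\{D\in X_N:L_jD=0,\ 1\le j\le J\}$ for given linear $L_j$. $\operatorname{dist}_0(D,\Gamma_N):=\operatorname{dist}(b,\Pi_B\Gamma_N)$, where $\Pi_B:X_N\to B_N$ is the coordinate projection. Stability under positive quotient normalization: if $D\in\mathcal A_N$ and $r=\operatorname{dist}_0(D,\Gamma_N)>0$ then $D/r\in\mathcal A_N$. Positive homogeneity: $M_N(\lambda D)=\lambda M_N(D)$ for $\lambda>0$ whenever $D,\lambda D\in\mathcal A_N$. $M^{\mathrm{loc}}_\Lambda:\mathcal A_N\to[0,\infty)$ is a given localized detector. Convention: $\inf\emptyset=+\infty$ and $(+\infty)\cdot0=0$. *)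

theory Defs
  imports "HOL-Analysis.Analysis" "HOL-Library.Extended_Real"
begin

text \<open>
  The coordinate spaces carry arbitrary norms, so they are types of class
  \<open>real_normed_vector\<close> with an explicit finite-dimensionality hypothesis; the class
  \<open>euclidean_space\<close> would force Hilbert norms and exclude the zero space.
\<close>

definition finite_dimensional :: "'a::real_vector itself \<Rightarrow> bool" where
  "finite_dimensional _ \<longleftrightarrow>
     (\<exists>Bs. finite_dimensional_vector_space (scaleR :: real \<Rightarrow> 'a \<Rightarrow> 'a) Bs)"

text \<open>
  Coordinates \<open>(b, t_CZ, t_harm, s, r)\<close>. The product type carries the product topology,
  i.e. the topology of every norm on the (finite-dimensional) direct sum.
\<close>

type_synonym ('b, 'c, 'h, 's, 'r) coords = "'b \<times> 'c \<times> 'h \<times> 's \<times> 'r"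

definition constraint_space ::
  "nat \<Rightarrow> (nat \<Rightarrow> ('b, 'c, 'h, 's, 'r) coords \<Rightarrow> 'w::zero) \<Rightarrow> ('b, 'c, 'h, 's, 'r) coords set" where
  "constraint_space J L = {D. \<forall>j\<in>{1..J}. L j D = 0}"

text \<open>
  The baseline projection is \<open>fst\<close>. The library sets \<open>infdist x {} = 0\<close>; this is harmless
  below, since a linear constraint space contains \<open>0\<close>.
\<close>

definition dist0 ::
  "('b::metric_space, 'c, 'h, 's, 'r) coords \<Rightarrow> ('b, 'c, 'h, 's, 'r) coords set \<Rightarrow> real" where
  "dist0 D G = infdist (fst D) (fst ` G)"

definition quotient_normalization_stable ::
  "('b::real_normed_vector, 'c::real_vector, 'h::real_vector, 's::real_vector, 'r::real_vector) coords set
    \<Rightarrow> ('b, 'c, 'h, 's, 'r) coords set \<Rightarrow> bool" where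
  "quotient_normalization_stable A G \<longleftrightarrow>
     (\<forall>D\<in>A. dist0 D G > 0 \<longrightarrow> D /\<^sub>R dist0 D G \<in> A)"

definition baseline_unit_section ::
  "('b::metric_space, 'c, 'h, 's, 'r) coords set
    \<Rightarrow> ('b, 'c, 'h, 's, 'r) coords set \<Rightarrow> ('b, 'c, 'h, 's, 'r) coords set" where
  "baseline_unit_section A G = {D \<in> A. dist0 D G = 1}"

definition positively_homogeneous_on :: "'a::real_vector set \<Rightarrow> ('a \<Rightarrow> real) \<Rightarrow> bool" where
  "positively_homogeneous_on A M \<longleftrightarrow>
     (\<forall>c>0. \<forall>D\<in>A. c *\<^sub>R D \<in> A \<longrightarrow> M (c *\<^sub>R D) = c * M D)"

definition kernel_free_on :: "'a set \<Rightarrow> 'a set \<Rightarrow> ('a \<Rightarrow> real) \<Rightarrow> bool" where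
  "kernel_free_on A G M \<longleftrightarrow> (\<forall>D\<in>A. M D = 0 \<longrightarrow> D \<in> G)"

text \<open>
  Extended-real valued, so that the infimum over an empty section is \<open>\<infinity>\<close>; moreover
  \<open>\<infinity> * 0 = 0\<close> in type \<open>ereal\<close>.
\<close>

definition baseline_modulus ::
  "('b::metric_space, 'c, 'h, 's, 'r) coords set \<Rightarrow> ('b, 'c, 'h, 's, 'r) coords set
    \<Rightarrow> (('b, 'c, 'h, 's, 'r) coords \<Rightarrow> real) \<Rightarrow> ereal" where
  "baseline_modulus A G M = (INF D\<in>baseline_unit_section A G. ereal (M D))"

end

theory Submission
  imports Defs
begin

text \<open>The argument is compactness on the section followed by rescaling. A continuous
  \<open>M\<close> attains its minimum on a nonempty compact section at some \<open>E\<close>; since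
  \<open>dist0 E \<Gamma> = 1\<close>, \<open>E\<close> is outside \<Gamma>, so kernel-freeness
  makes this minimum positive (\<open>baseline_modulus_pos\<close>). As \<Gamma> is a subspace, so
  is its baseline projection, and \<open>dist0\<close> is positively homogeneous
  (\<open>dist0_scaleR\<close>). A point \<open>D\<close> with
  \<open>r = dist0 D \<Gamma> > 0\<close> therefore rescales into the section, where
  \<open>M\<close> is at least the modulus; homogeneity of \<open>M\<close> turns this into modulus
  times \<open>r\<close> at most \<open>M D\<close>
  (\<open>baseline_modulus_times_dist0_le\<close>). If \<open>r = 0\<close>, nonnegativity of
  \<open>M\<close> suffices. Inserting this bound into the localization inequality gives the
  estimate for \<open>Mloc\<close>.\<close>

lemma infdist_scaleR_ge:
  fixes x :: "'a::real_normed_vector"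
  assumes "c > 0"
  shows "c * infdist x S \<le> infdist (c *\<^sub>R x) ((*\<^sub>R) c ` S)"
\<comment> \<open>The empty set is split off because \<open>infdist\<close> to it is 0 by convention
  rather than an infimum; both sides are then 0.\<close>
proof (cases "S = {}")
  case False
  have "c * infdist x S \<le> (INF y\<in>(*\<^sub>R) c ` S. dist (c *\<^sub>R x) y)"
  proof (rule cINF_greatest)
    fix y assume "y \<in> (*\<^sub>R) c ` S"
    then obtain z where z: "z \<in> S" "y = c *\<^sub>R z" by blast
    have "dist (c *\<^sub>R x) y = c * dist x z"
      using assms z by (simp add: dist_norm flip: scaleR_diff_right)
    then show "c * infdist x S \<le> dist (c *\<^sub>R x) y"
      using infdist_le[OF z(1)] assms by (simp add: mult_left_mono)
  qed (use False in simp)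
  then show ?thesis using False by (simp add: infdist_notempty)
qed (simp add: infdist_def)

text \<open>Scaling by \<open>c\<close> is invertible, so the one-sided bound, applied again with
  \<open>inverse c\<close> to the scaled point and set, yields the reverse inequality.\<close>

lemma infdist_scaleR:
  fixes x :: "'a::real_normed_vector"
  assumes "c > 0"
  shows "infdist (c *\<^sub>R x) ((*\<^sub>R) c ` S) = c * infdist x S"
proof (rule antisym)
  have "inverse c * infdist (c *\<^sub>R x) ((*\<^sub>R) c ` S) \<le> infdist x S"
    using infdist_scaleR_ge[of "inverse c" "c *\<^sub>R x" "(*\<^sub>R) c ` S"] assms
    by (simp add: image_image)
  then show "infdist (c *\<^sub>R x) ((*\<^sub>R) c ` S) \<le> c * infdist x S"
    using assms by (simp add: field_simps)
qed (rule infdist_scaleR_ge[OF assms])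

lemma scaleR_image_subspace:
  assumes "subspace S" "c \<noteq> 0"
  shows "(*\<^sub>R) c ` S = S"
proof (intro antisym subsetI)
  fix x assume "x \<in> S"
  then have "x /\<^sub>R c \<in> S"
    by (rule subspace_scale[OF assms(1)])
  then have "c *\<^sub>R (x /\<^sub>R c) \<in> (*\<^sub>R) c ` S"
    by (rule imageI)
  then show "x \<in> (*\<^sub>R) c ` S"
    using assms(2) by simp
qed (use subspace_scale[OF assms(1)] in blast)

lemma subspace_constraint_space:
  assumes "\<And>j. j \<in> {1..J} \<Longrightarrow> linear (L j)"
  shows "subspace (constraint_space J L)"
  unfolding subspace_def constraint_space_def
  using assms by (auto simp: linear_0 linear_add linear_scale)

lemma dist0_scaleR:
  fixes G :: "('b::real_normed_vector, 'c::real_vector, 'h::real_vector,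
                's::real_vector, 'r::real_vector) coords set"
  assumes "subspace G" "c > 0"
  shows "dist0 (c *\<^sub>R D) G = c * dist0 D G"
proof -
  have "subspace (fst ` G)"
    using assms(1) by (rule linear_subspace_image[OF linear_fst])
  then have "(*\<^sub>R) c ` fst ` G = fst ` G"
    using assms(2) by (intro scaleR_image_subspace) auto
  then show ?thesis
    using infdist_scaleR[OF assms(2), of "fst D" "fst ` G"] by (simp add: dist0_def)
qed

lemma baseline_modulus_pos:
  fixes A \<Gamma> :: "('b::real_normed_vector, 'c::real_normed_vector, 'h::real_normed_vector,
                's::real_normed_vector, 'r::real_normed_vector) coords set"
  assumes "compact (baseline_unit_section A \<Gamma>)" "continuous_on A M"
    and nonneg: "\<And>D. D \<in> A \<Longrightarrow> 0 \<le> M D" and "kernel_free_on A \<Gamma> M"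
  shows "baseline_modulus A \<Gamma> M > 0"
proof (cases "baseline_unit_section A \<Gamma> = {}")
  case True
  \<comment> \<open>The infimum over the empty section is \<infinity>, which is positive.\<close>
  then show ?thesis by (simp add: baseline_modulus_def top_ereal_def)
next
  case False
  have "continuous_on (baseline_unit_section A \<Gamma>) M"
    by (rule continuous_on_subset[OF assms(2)]) (auto simp: baseline_unit_section_def)
  then obtain E where E: "E \<in> baseline_unit_section A \<Gamma>"
    and le: "\<And>D. D \<in> baseline_unit_section A \<Gamma> \<Longrightarrow> M E \<le> M D"
    using continuous_attains_inf[OF assms(1) False] by blast
  have EA: "E \<in> A" and E1: "dist0 E \<Gamma> = 1"
    using E by (auto simp: baseline_unit_section_def)
  \<comment> \<open>Membership would put \<open>fst E\<close> in the projection of \<Gamma> and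
    force distance 0 instead of 1.\<close>
  have "E \<notin> \<Gamma>"
    using E1 by (auto simp: dist0_def)
  then have "0 < M E"
    using nonneg[OF EA] assms(4) EA by (force simp: kernel_free_on_def)
  also have "ereal (M E) \<le> baseline_modulus A \<Gamma> M"
    unfolding baseline_modulus_def by (rule INF_greatest) (simp add: le)
  finally show ?thesis by (simp add: zero_ereal_def)
qed

lemma baseline_modulus_times_dist0_le:
  fixes A \<Gamma> :: "('b::real_normed_vector, 'c::real_normed_vector, 'h::real_normed_vector,
                's::real_normed_vector, 'r::real_normed_vector) coords set"
  assumes "subspace \<Gamma>" "quotient_normalization_stable A \<Gamma>" "positively_homogeneous_on A M"
    and "D \<in> A" "0 \<le> M D"
  shows "baseline_modulus A \<Gamma> M * ereal (dist0 D \<Gamma>) \<le> ereal (M D)"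
proof (cases "dist0 D \<Gamma> = 0")
  case True
  \<comment> \<open>The product is 0 even for an infinite modulus. \<open>D\<close> itself may lie
    outside \<Gamma>, since only its baseline coordinate is measured.\<close>
  then show ?thesis using assms(5) by (simp flip: zero_ereal_def)
next
  case False
  define r where "r = dist0 D \<Gamma>"
  have r: "r > 0"
    using False infdist_nonneg[of "fst D" "fst ` \<Gamma>"] by (simp add: r_def dist0_def)
  have A: "D /\<^sub>R r \<in> A"
    using assms(2,4) r by (auto simp: quotient_normalization_stable_def r_def)
  have "dist0 (D /\<^sub>R r) \<Gamma> = 1"
    using dist0_scaleR[OF assms(1), of "inverse r" D] r by (simp flip: r_def)
  \<comment> \<open>The normalized point lies in the section, so the section is nonempty here and
    the modulus is bounded by a finite value.\<close>
  with A have "baseline_modulus A \<Gamma> M \<le> ereal (M (D /\<^sub>R r))"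
    unfolding baseline_modulus_def by (intro INF_lower) (simp add: baseline_unit_section_def)
  then have "baseline_modulus A \<Gamma> M * ereal r \<le> ereal (M (D /\<^sub>R r)) * ereal r"
    using r by (intro ereal_mult_right_mono) auto
  moreover have "M (D /\<^sub>R r) = M D / r"
    using assms(3,4) A r unfolding positively_homogeneous_on_def
    by (metis divide_inverse_commute positive_imp_inverse_positive)
  ultimately show ?thesis
    using r by (simp flip: r_def)
qed

theorem theorem9p4:
  fixes J :: nat
    and L :: "nat \<Rightarrow> ('b::real_normed_vector, 'c::real_normed_vector, 'h::real_normed_vector,
                's::real_normed_vector, 'r::real_normed_vector) coords \<Rightarrow> 'w::real_vector"
    and \<Gamma> A :: "('b, 'c, 'h, 's, 'r) coords set"
    and M Mloc Err :: "('b, 'c, 'h, 's, 'r) coords \<Rightarrow> real"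
    and Cres \<Delta> :: real
  assumes fin_dim: "finite_dimensional TYPE('b)" "finite_dimensional TYPE('c)"
      "finite_dimensional TYPE('h)" "finite_dimensional TYPE('s)" "finite_dimensional TYPE('r)"
    and L_linear: "\<And>j. j \<in> {1..J} \<Longrightarrow> linear (L j)"
    and Gamma_def: "\<Gamma> = constraint_space J L"
    and A_stable: "quotient_normalization_stable A \<Gamma>"
    and section_compact: "compact (baseline_unit_section A \<Gamma>)"
    and M_nonneg: "\<And>D. D \<in> A \<Longrightarrow> 0 \<le> M D"
    and M_continuous: "continuous_on A M"
    and M_homogeneous: "positively_homogeneous_on A M"
    and M_kernel_free: "kernel_free_on A \<Gamma> M"
    and Mloc_nonneg: "\<And>D. D \<in> A \<Longrightarrow> 0 \<le> Mloc D"
    and Delta_nonneg: "0 \<le> \<Delta>"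
    and Err_nonneg: "\<And>D. D \<in> A \<Longrightarrow> 0 \<le> Err D"
    and localization: "\<And>D. D \<in> A \<Longrightarrow> Mloc D \<ge> M D - Cres * Err D - \<Delta>"
  shows "baseline_modulus A \<Gamma> M > 0 \<and>
    (\<forall>D\<in>A. ereal (Mloc D) \<ge>
       baseline_modulus A \<Gamma> M * ereal (dist0 D \<Gamma>) - ereal (Cres * Err D) - ereal \<Delta>)"
proof (intro conjI ballI)
  show "baseline_modulus A \<Gamma> M > 0"
    by (rule baseline_modulus_pos[OF section_compact M_continuous M_nonneg M_kernel_free])
next
  fix D assume D: "D \<in> A"
  have "subspace \<Gamma>"
    unfolding Gamma_def by (rule subspace_constraint_space[OF L_linear])
  then have "baseline_modulus A \<Gamma> M * ereal (dist0 D \<Gamma>) \<le> ereal (M D)"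
    by (rule baseline_modulus_times_dist0_le[OF _ A_stable M_homogeneous D M_nonneg[OF D]])
  \<comment> \<open>The subtraction stays in \<open>ereal\<close> because the modulus may be
    infinite; after this bound all terms are real and \<open>localization\<close> applies
    directly.\<close>
  then have "baseline_modulus A \<Gamma> M * ereal (dist0 D \<Gamma>) - ereal (Cres * Err D) - ereal \<Delta>
      \<le> ereal (M D) - ereal (Cres * Err D) - ereal \<Delta>"
    by (intro ereal_minus_mono order_refl)
  also have "\<dots> \<le> ereal (Mloc D)"
    using localization[OF D] by simp
  finally show "ereal (Mloc D) \<ge>
      baseline_modulus A \<Gamma> M * ereal (dist0 D \<Gamma>) - ereal (Cres * Err D) - ereal \<Delta>" .
qed

end
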